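(* Let $q$ be a prime, let $(n_m)_{m\ge 0}$ be a sequence of non-negative integers, and let $(\mathbb{F}_q^{n_m},A_m)$ be a uniform random chain complex over $\mathbb{F}_q$ with $m$-th Betti number $\beta_m$. Then for every integer $m\ge 1$ and every integer $b$, \[ \mathbb{P}[\beta_m=b]=\sum_{i_m=0}^{n_m}P^m_{i_m}(i_m-b)\sum_{i_{m-1}=0}^{n_{m-1}}P^{m-1}_{i_{m-1}}(n_m-i_m)\cdots\sum_{i_1=0}^{n_1}P^1_{i_1}(n_2-i_2)\,P^0_{n_0}(n_1-i_1). \] (The sums are nested: the right-hand side is the sum over all $(i_1,\dots,i_m)\in\prod_{\ell=1}^m\{0,\dots,n_\ell\}$ of $P^m_{i_m}(i_m-b)\prod_{\ell=1}^{m}P^{\ell-1}_{i_{\ell-1}}(n_\ell-i_\ell)$, where $i_0:=n_0$.)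
   Context: Uniform random chain complex: given a prime $q$ and non-negative integers $(n_m)_{m\ge0}$, it is a random sequence of matrices $A_m$ over $\mathbb{F}_q$ ($m\ge 0$), where $A_m$ has size $n_{m-1}\times n_m$ for $m\geq 1$ and is regarded as a linear map $\mathbb{F}_q^{n_m}\to\mathbb{F}_q^{n_{m-1}}$, and $A_0:\mathbb{F}_q^{n_0}\to 0$ is the zero map. The matrices are chosen successively: for each $m\ge0$, given $A_0,\dots,A_m$, the matrix $A_{m+1}$ is uniformly distributed over all $n_m\times n_{m+1}$ matrices over $\mathbb{F}_q$ satisfying $A_mA_{m+1}=0$ (i.e. entries i.i.d. uniform on $\mathbb{F}_q$, conditioned on $A_mA_{m+1}=0$). Betti number: $\beta_m=\operatorname{nul}(A_m)-\operatorname{rank}(A_{m+1})=\dim_{\mathbb{F}_q}(\ker A_m/\operatorname{im}A_{m+1})$, where $\operatorname{nul}$ denotes the dimension of the kernel. Notation: for integers $m\ge0$, $k\ge0$, $r\ge 0$, \[ P^m_k(r)=q^{-kn_{m+1}}\prod_{j=0}^{r-1}\frac{(q^{n_{m+1}}-q^j)(q^k-q^j)}{q^r-q^j}, \] with the empty product equal to $1$, and $P^m_k(r)=0$ for $r<0$. *)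

theory Defs
  imports
    "HOL-Probability.Probability"
    "Jordan_Normal_Form.Matrix_Kernel"
    "Jordan_Normal_Form.DL_Rank"
begin

text \<open>
  The degree-\<open>m\<close> boundary map \<open>A m\<close> has \<open>bdry_rows n m\<close> rows and \<open>n m\<close> columns; in degree
  \<open>0\<close> the target is the zero space.
\<close>

fun bdry_rows :: "(nat \<Rightarrow> nat) \<Rightarrow> nat \<Rightarrow> nat" where
  "bdry_rows n 0 = 0"
| "bdry_rows n (Suc m) = n m"

definition next_boundaries ::
  "(nat \<Rightarrow> nat) \<Rightarrow> nat \<Rightarrow> 'a::field mat \<Rightarrow> 'a mat set" where
  "next_boundaries n m B =
     {C \<in> carrier_mat (n m) (n (Suc m)). B * C = 0\<^sub>m (bdry_rows n m) (n (Suc m))}"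

text \<open>
  The space \<open>carrier_mat 0 (n 0)\<close> has a single element, so the first assumption already says
  that \<open>A 0\<close> is the zero map. All matrix spaces are finite, hence conditioning on
  \<open>A\<^sub>0, \<dots>, A\<^sub>m\<close> amounts to conditioning on their values. Values of probability zero are left
  out because \<open>cond_prob\<close> is \<open>0\<close> there by convention.
\<close>

locale uniform_random_chain_complex = prob_space M
  for M :: "'w measure" and n :: "nat \<Rightarrow> nat" and A :: "nat \<Rightarrow> 'w \<Rightarrow> 'a::{field, finite} mat" +
  assumes random_boundary:
      "\<And>m. random_variable (count_space (carrier_mat (bdry_rows n m) (n m))) (A m)"
    and conditionally_uniform:
      "\<And>m B C. \<P>(\<omega> in M. \<forall>i\<le>m. A i \<omega> = B i) > 0 \<Longrightarrow>
         \<P>(\<omega> in M. A (Suc m) \<omega> = C \<bar> \<forall>i\<le>m. A i \<omega> = B i)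
           = pmf (pmf_of_set (next_boundaries n m (B m))) C"

definition mat_rank :: "'a::field mat \<Rightarrow> nat" where
  "mat_rank A = vec_space.rank (dim_row A) A"

definition betti :: "(nat \<Rightarrow> 'a::field mat) \<Rightarrow> nat \<Rightarrow> int" where
  "betti A m = int (kernel_dim (A m)) - int (mat_rank (A (Suc m)))"

text \<open>\<open>rank_prob q n m k r\<close> is \<open>P\<^sup>m\<^sub>k(r)\<close>.\<close>

definition rank_prob :: "nat \<Rightarrow> (nat \<Rightarrow> nat) \<Rightarrow> nat \<Rightarrow> nat \<Rightarrow> int \<Rightarrow> real" where
  "rank_prob q n m k r =
     (if r < 0 then 0
      else real q powi (- int (k * n (Suc m))) *
        (\<Prod>j<nat r. (real q ^ n (Suc m) - real q ^ j) * (real q ^ k - real q ^ j)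
                      / (real q ^ nat r - real q ^ j)))"

end

theory Submission
  imports Defs
begin

text \<open>
  Since \<open>nul A\<^sub>m = n\<^sub>m - rank A\<^sub>m\<close>, the pair \<open>(nul A\<^sub>m, rank A\<^sub>m\<^sub>+\<^sub>1)\<close> determines the Betti
  number, and it suffices to know the law of \<open>rank A\<^sub>m\<^sub>+\<^sub>1\<close> given \<open>A\<^sub>0, \<dots>, A\<^sub>m\<close>. The columns of
  \<open>A\<^sub>m\<^sub>+\<^sub>1\<close> are independent uniform vectors of \<open>ker A\<^sub>m\<close>, so this law depends only on the
  dimension \<open>k\<close> of that kernel. Adding the columns one at a time, the rank grows
  unless the new column lies in the span of the previous ones; the resulting recursion for the
  number of \<open>p\<close>-tuples of rank \<open>r\<close> in a \<open>k\<close>-dimensional space is the \<open>q\<close>-Pascal rule. Hence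
  the nullities form a Markov chain whose transition from \<open>i\<close> to \<open>j\<close> in step \<open>m\<close> has probability
  \<open>P\<^sup>m\<^sub>i(n\<^sub>m\<^sub>+\<^sub>1 - j)\<close>, and summing over its paths gives the formula. A dimension \<open>d\<close> is read off from the cardinality \<open>q\<^sup>d\<close> throughout.
\<close>

subsection \<open>Cardinalities of spans and kernels\<close>

text \<open>Coordinates with respect to a finite basis identify the space with the functions from
  the basis to the scalars.\<close>

lemma (in vectorspace) card_carrier_eq_power_dim:
  assumes "fin_dim"
  shows "card (carrier V) = card (carrier K) ^ dim"
proof -
  obtain B where B: "finite B" "basis B"
    using finite_basis_exists[OF assms] by blast
  have BV: "B \<subseteq> carrier V" using B(2) by (simp add: basis_def)
  have ex1: "\<exists>!a. a \<in> B \<rightarrow>\<^sub>E carrier K \<and> lincomb a B = v" if "v \<in> carrier V" for v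
    using basis_criterion[OF B(1) BV] B(2) that by blast
  have "lincomb a B \<in> carrier V" if "a \<in> B \<rightarrow>\<^sub>E carrier K" for a
    using that BV by (intro lincomb_closed) (auto simp: PiE_def)
  then have "bij_betw (\<lambda>a. lincomb a B) (B \<rightarrow>\<^sub>E carrier K) (carrier V)"
    using ex1 by (intro bij_betw_imageI inj_onI) (blast, force)
  then have "card (carrier V) = card (B \<rightarrow>\<^sub>E carrier K)"
    by (simp add: bij_betw_same_card)
  then show ?thesis
    by (simp add: card_funcsetE[OF B(1)] dim_basis[OF B])
qed

lemma finite_carrier_vec [simp]: "finite (carrier_vec n :: 'a::finite vec set)"
proof (rule finite_subset)
  show "carrier_vec n \<subseteq> vec_of_list ` {xs :: 'a list. set xs \<subseteq> UNIV \<and> length xs = n}"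
  proof
    fix v :: "'a vec" assume "v \<in> carrier_vec n"
    then have "v = vec_of_list (list_of_vec v)" "length (list_of_vec v) = n"
      by (auto simp: vec_list)
    then show "v \<in> vec_of_list ` {xs :: 'a list. set xs \<subseteq> UNIV \<and> length xs = n}" by blast
  qed
  show "finite (vec_of_list ` {xs :: 'a list. set xs \<subseteq> UNIV \<and> length xs = n})"
    by (intro finite_imageI finite_lists_length_eq) simp
qed

lemma card_mat_kernel:
  fixes A :: "'a::{field, finite} mat"
  shows "card (mat_kernel A) = CARD('a) ^ kernel_dim A"
proof -
  interpret kernel "dim_row A" "dim_col A" A by unfold_locales auto
  obtain B where "finite B" "basis B" using kernel_basis_exists[of A] by blast
  then have "Ker.fin_dim" unfolding Ker.fin_dim_def Ker.basis_def by auto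
  then show ?thesis using Ker.card_carrier_eq_power_dim by simp
qed

text \<open>Turns counting matrices into counting lists of columns. The inverse
  \<open>mat_of_cols n\<close> receives the number of rows explicitly, so the empty list is covered
  as well.\<close>

lemma bij_betw_cols:
  "bij_betw cols (carrier_mat n p) {vs. set vs \<subseteq> carrier_vec n \<and> length vs = p}"
proof (rule bij_betw_byWitness[where f' = "mat_of_cols n"])
  show "\<forall>C\<in>carrier_mat n p. mat_of_cols n (cols C) = C" by auto
  show "\<forall>vs\<in>{vs. set vs \<subseteq> carrier_vec n \<and> length vs = p}. cols (mat_of_cols n vs) = vs"
    by (auto intro!: cols_mat_of_cols)
  show "cols ` carrier_mat n p \<subseteq> {vs. set vs \<subseteq> carrier_vec n \<and> length vs = p}"
    using cols_dim by fastforce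
  show "mat_of_cols n ` {vs. set vs \<subseteq> carrier_vec n \<and> length vs = p} \<subseteq> carrier_mat n p"
    by auto
qed

lemma one_less_card_field: "1 < CARD('a::{field, finite})"
  using card_mono[of UNIV "{0, 1 :: 'a}"] by simp

locale finite_vec_space = vec_space f_ty n
  for f_ty :: "'a::{field, finite} itself" and n :: nat
begin

text \<open>The rank is the dimension of the column span, so it is encoded in the size of that span;
  the counting below works with sizes only.\<close>

lemma card_span_cols:
  assumes A: "A \<in> carrier_mat n nc"
  shows "card (span (set (cols A))) = CARD('a) ^ mat_rank A"
proof -
  have S: "set (cols A) \<subseteq> carrier_vec n" using A cols_dim by fastforce
  interpret S: vectorspace class_ring "span_vs (set (cols A))"
    using S span_is_subspace subspace_def subspace_is_vs by simp
  have "card (carrier (span_vs (set (cols A)))) = CARD('a) ^ S.dim"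
    using S.card_carrier_eq_power_dim[OF fin_dim_span_cols[OF A]] by simp
  then show ?thesis using A by (simp add: mat_rank_def rank_def)
qed

text \<open>Each vector of the larger span is \<open>c v + s\<close> for exactly one scalar
  \<open>c\<close> and one \<open>s\<close> in \<open>span S\<close>.\<close>

lemma card_span_insert:
  assumes S: "S \<subseteq> carrier_vec n" and v: "v \<in> carrier_vec n" "v \<notin> span S"
  shows "card (span (insert v S)) = CARD('a) * card (span S)"
proof -
  let ?f = "\<lambda>(c, s). c \<cdot>\<^sub>v v + s"
  have sc: "s \<in> carrier_vec n" if "s \<in> span S" for s using that S span_is_subset2 by blast
  have span_v: "span {v} = range (\<lambda>c. c \<cdot>\<^sub>v v)"
  proof
    show "span {v} \<subseteq> range (\<lambda>c. c \<cdot>\<^sub>v v)"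
    proof
      fix u assume "u \<in> span {v}"
      then obtain a U where U: "u = lincomb a U" "U \<subseteq> {v}" using in_spanE by blast
      show "u \<in> range (\<lambda>c. c \<cdot>\<^sub>v v)"
      proof (cases "U = {}")
        case True
        then have "u = 0 \<cdot>\<^sub>v v" using U v by (simp add: lincomb_def)
        then show ?thesis by blast
      next
        case False
        then have "U = {v}" using U by blast
        then have "u = a v \<cdot>\<^sub>v v" using U v by (simp add: lincomb_def)
        then show ?thesis by blast
      qed
    qed
    have "v \<in> span {v}" using v by (intro span_mem) auto
    then show "range (\<lambda>c. c \<cdot>\<^sub>v v) \<subseteq> span {v}" using v smult_in_span[of "{v}" v] by auto
  qed
  have "span (insert v S) = submodule_sum (span {v}) (span S)"
    using span_union_is_sum[of "{v}" S] S v by simp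
  also have "\<dots> = ?f ` (UNIV \<times> span S)"
    unfolding submodule_sum_def span_v by (auto simp: image_iff)
  finally have eq: "span (insert v S) = ?f ` (UNIV \<times> span S)" .
  have inj: "inj_on ?f (UNIV \<times> span S)"
  proof (rule inj_onI, clarify)
    fix c s d t assume st: "s \<in> span S" "t \<in> span S" and e: "c \<cdot>\<^sub>v v + s = d \<cdot>\<^sub>v v + t"
    have idx: "c * vec_index v i + vec_index s i = d * vec_index v i + vec_index t i" if "i < n" for i
      using arg_cong[OF e, of "\<lambda>w. vec_index w i"] that sc[OF st(1)] sc[OF st(2)] v by simp
    have cd: "c = d"
    proof (rule ccontr)
      assume "c \<noteq> d"
      \<comment> \<open>Two representations with different scalars could be solved for
        \<open>v\<close>, which would put \<open>v\<close> into \<open>span S\<close>.\<close>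
      then have "v = inverse (c - d) \<cdot>\<^sub>v (t + (-1) \<cdot>\<^sub>v s)"
        using idx sc[OF st(1)] sc[OF st(2)] v by (intro eq_vecI) (auto simp: field_simps)
      also have "\<dots> \<in> span S"
        using S st by (intro smult_in_span span_add1) auto
      finally show False using v(2) by simp
    qed
    moreover have "s = t"
      using idx sc[OF st(1)] sc[OF st(2)] cd by (intro eq_vecI) auto
    ultimately show "c = d \<and> s = t" by simp
  qed
  show ?thesis unfolding eq by (simp add: card_image[OF inj] card_cartesian_product)
qed

end

subsection \<open>Counting tuples of vectors by rank\<close>

text \<open>The products are Gaussian binomial coefficients, and this is their Pascal rule:
  [p+1, r+1] = q^(r+1) [p, r+1] + [p, r].\<close>

lemma q_pascal:
  fixes q :: real
  assumes "q > 1"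
  shows "(\<Prod>j<Suc r. (q ^ Suc p - q ^ j) / (q ^ Suc r - q ^ j)) =
    q ^ Suc r * (\<Prod>j<Suc r. (q ^ p - q ^ j) / (q ^ Suc r - q ^ j)) +
    (\<Prod>j<r. (q ^ p - q ^ j) / (q ^ r - q ^ j))"
proof -
  define N where "N = (\<Prod>j<r. q ^ p - q ^ j)"
  define D where "D = (\<Prod>j<r. q ^ r - q ^ j)"
  have D: "D \<noteq> 0" unfolding D_def using assms by auto
  \<comment> \<open>The factor \<open>j = 0\<close> is split off and one \<open>q\<close> is pulled
    out of each of the other \<open>r\<close> factors. It serves numerators with
    \<open>s = p\<close> and denominators with \<open>s = r\<close>.\<close>
  have shift: "(\<Prod>j<Suc r. q ^ Suc s - q ^ j) = (q ^ Suc s - 1) * (q ^ r * (\<Prod>j<r. q ^ s - q ^ j))" for s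
  proof -
    have "(\<Prod>j<r. q ^ Suc s - q ^ Suc j) = (\<Prod>j<r. q * (q ^ s - q ^ j))"
      by (simp add: algebra_simps)
    then show ?thesis by (simp only: prod.lessThan_Suc_shift prod.distrib) simp
  qed
  have q1: "q ^ Suc r - 1 \<noteq> 0" using one_less_power[OF assms, of "Suc r"] by simp
  have qr: "q ^ r \<noteq> 0" using assms by simp
  have "(\<Prod>j<Suc r. (q ^ Suc p - q ^ j) / (q ^ Suc r - q ^ j))
      = ((q ^ Suc p - 1) * (q ^ r * N)) / ((q ^ Suc r - 1) * (q ^ r * D))"
    unfolding prod_dividef shift N_def D_def ..
  moreover have "(\<Prod>j<Suc r. (q ^ p - q ^ j) / (q ^ Suc r - q ^ j))
      = (N * (q ^ p - q ^ r)) / ((q ^ Suc r - 1) * (q ^ r * D))"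
    unfolding prod_dividef shift D_def by (simp add: N_def)
  moreover have "(\<Prod>j<r. (q ^ p - q ^ j) / (q ^ r - q ^ j)) = N / D"
    unfolding prod_dividef N_def D_def ..
  moreover have "((q ^ Suc p - 1) * (q ^ r * N)) / ((q ^ Suc r - 1) * (q ^ r * D))
      = q ^ Suc r * ((N * (q ^ p - q ^ r)) / ((q ^ Suc r - 1) * (q ^ r * D))) + N / D"
  proof -
    define Q where "Q = q ^ Suc r - 1"
    have Q: "Q \<noteq> 0" "q * q ^ r = Q + 1" using q1 by (simp_all add: Q_def)
    have "q ^ Suc r * ((N * (q ^ p - q ^ r)) / (Q * (q ^ r * D))) + N / D
        = (q * (N * (q ^ p - q ^ r)) + N * Q) / (Q * D)"
      using Q(1) qr D by (simp add: field_simps)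
    \<comment> \<open>Over the common denominator \<open>Q * D\<close> the two occurrences of
      \<open>q ^ Suc r\<close> cancel.\<close>
    also have "q * (N * (q ^ p - q ^ r)) + N * Q = (q ^ Suc p - 1) * N"
      by (simp add: Q_def algebra_simps)
    also have "\<dots> / (Q * D) = ((q ^ Suc p - 1) * (q ^ r * N)) / (Q * (q ^ r * D))"
      using Q(1) qr D by (simp add: field_simps)
    finally show ?thesis unfolding Q_def by simp
  qed
  ultimately show ?thesis by simp
qed

context finite_vec_space
begin

text \<open>Here \<open>K\<close> is a \<open>k\<close>-dimensional subspace, given by its closure
  under spans and its size, and rank \<open>r\<close> means a span of size q^r. Induction on
  \<open>p\<close>: a new vector inside the span of the others keeps the rank, one outside raises it
  by one. The result is a Gaussian binomial coefficient times the number of linearly independent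
  \<open>r\<close>-tuples in \<open>K\<close>.\<close>

lemma card_lists_card_span:
  assumes K: "K \<subseteq> carrier_vec n" "\<And>S. S \<subseteq> K \<Longrightarrow> span S \<subseteq> K" "card K = CARD('a) ^ k"
  defines "q \<equiv> real CARD('a)"
  shows "real (card {vs. set vs \<subseteq> K \<and> length vs = p \<and> card (span (set vs)) = CARD('a) ^ r}) =
    (\<Prod>j<r. (q ^ p - q ^ j) * (q ^ k - q ^ j) / (q ^ r - q ^ j))"
proof -
  define L where "L p r = {vs. set vs \<subseteq> K \<and> length vs = p \<and> card (span (set vs)) = CARD('a) ^ r}" for p r
  define F where "F p r = (\<Prod>j<r. (q ^ p - q ^ j) * (q ^ k - q ^ j) / (q ^ r - q ^ j))" for p r
  have q_gt_1: "CARD('a) > 1" by (rule one_less_card_field)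
  then have q1: "q > 1" by (simp add: q_def)
  have card_power_1: "1 = CARD('a) ^ r \<longleftrightarrow> r = 0" for r
    using one_less_power[OF q_gt_1, of r] by (cases "r = 0") auto
  have finK: "finite K" using K(1) finite_carrier_vec finite_subset by blast
  have finL: "finite (L p r)" for p r
    using finite_lists_length_eq[OF finK, of p] by (rule rev_finite_subset) (auto simp: L_def)
  have spanK: "span (set vs) \<subseteq> K" if "vs \<in> L p r" for vs p r
    using that K(2) by (auto simp: L_def)
  have span_insert: "card (span (insert v (set vs))) =
      (if v \<in> span (set vs) then card (span (set vs)) else CARD('a) * card (span (set vs)))"
    if "set vs \<subseteq> K" "v \<in> K" for v vs
    using card_span_insert[of "set vs" v] already_in_span[of "set vs" v] that K(1) by auto
  \<comment> \<open>A longer list is a pair of a list and its new first vector. Over lists of rank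
    \<open>r\<close> all fibres have equal size: q^r vectors inside the span, and q^k - q^r outside
    (\<open>card_out\<close>).\<close>
  have card_in: "card (SIGMA vs:L p r. span (set vs)) = CARD('a) ^ r * card (L p r)" for p r
  proof -
    have "card (SIGMA vs:L p r. span (set vs)) = (\<Sum>vs\<in>L p r. card (span (set vs)))"
      using finL finite_subset[OF spanK finK] by (intro card_SigmaI) auto
    also have "\<dots> = (\<Sum>vs\<in>L p r. CARD('a) ^ r)" by (rule sum.cong) (auto simp: L_def)
    finally show ?thesis by simp
  qed
  have card_out: "real (card (SIGMA vs:L p r. K - span (set vs))) = (q ^ k - q ^ r) * real (card (L p r))"
    for p r
  proof -
    have "card (SIGMA vs:L p r. K - span (set vs)) = (\<Sum>vs\<in>L p r. card (K - span (set vs)))"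
      using finL finK by (intro card_SigmaI) auto
    also have "real \<dots> = (\<Sum>vs\<in>L p r. q ^ k - q ^ r)"
      unfolding of_nat_sum
    proof (rule sum.cong)
      fix vs assume vs: "vs \<in> L p r"
      have "card (span (set vs)) \<le> card K" by (rule card_mono[OF finK spanK[OF vs]])
      then show "real (card (K - span (set vs))) = q ^ k - q ^ r"
        using vs card_Diff_subset[OF finite_subset[OF spanK[OF vs] finK] spanK[OF vs]] K(3)
        by (simp add: L_def q_def of_nat_diff)
    qed simp
    finally show ?thesis by simp
  qed
  have inj: "inj_on (\<lambda>(vs, v). v # vs) X" for X :: "('a vec list \<times> 'a vec) set"
    by (auto simp: inj_on_def)
  \<comment> \<open>Rank 0 cannot arise by an increase. The case distinction says so, since
    \<open>r - 1\<close> would be \<open>0\<close> for \<open>r = 0\<close>.\<close>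
  have L_Suc: "L (Suc p) r = (\<lambda>(vs, v). v # vs) ` ((SIGMA vs:L p r. span (set vs)) \<union>
      (SIGMA vs:(if r = 0 then {} else L p (r - 1)). K - span (set vs)))" (is "_ = _ ` (?X p r \<union> ?Y p r)")
    for p r
  proof (intro equalityI subsetI)
    fix ws assume ws: "ws \<in> L (Suc p) r"
    then obtain v vs where eq: "ws = v # vs" "length vs = p" by (auto simp: L_def length_Suc_conv)
    have vK: "v \<in> K" "set vs \<subseteq> K" using ws eq by (auto simp: L_def)
    show "ws \<in> (\<lambda>(vs, v). v # vs) ` (?X p r \<union> ?Y p r)"
    proof (cases "v \<in> span (set vs)")
      case True
      then have "(vs, v) \<in> ?X p r" using ws eq vK span_insert[OF vK(2,1)] by (auto simp: L_def)
      then show ?thesis using eq(1) by force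
    next
      case False
      then have c: "CARD('a) * card (span (set vs)) = CARD('a) ^ r"
        using ws eq vK span_insert[OF vK(2,1)] by (auto simp: L_def)
      have "r \<noteq> 0"
        using c q_gt_1 by (cases r) auto
      then obtain r' where "r = Suc r'" by (cases r) auto
      then have "(vs, v) \<in> ?Y p r" using c False eq vK by (auto simp: L_def)
      then show ?thesis using eq(1) by force
    qed
  next
    fix ws assume "ws \<in> (\<lambda>(vs, v). v # vs) ` (?X p r \<union> ?Y p r)"
    then obtain v vs where eq: "ws = v # vs" and vs: "(vs, v) \<in> ?X p r \<union> ?Y p r" by auto
    show "ws \<in> L (Suc p) r"
      using vs
    proof
      assume "(vs, v) \<in> ?X p r"
      then have h: "vs \<in> L p r" "v \<in> span (set vs)" by auto
      then have "v \<in> K" "set vs \<subseteq> K" using spanK by (auto simp: L_def)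
      from span_insert[OF this(2,1)] this h show ?thesis by (auto simp: L_def eq)
    next
      assume "(vs, v) \<in> ?Y p r"
      then have h: "vs \<in> L p (r - 1)" "v \<in> K" "v \<notin> span (set vs)" "r \<noteq> 0" by (auto split: if_splits)
      then have "v \<in> K" "set vs \<subseteq> K" by (auto simp: L_def)
      from span_insert[OF this(2,1)] this h show ?thesis
        by (cases r) (auto simp: L_def eq)
    qed
  qed
  have card_L: "real (card (L p r)) = F p r" for r
  proof (induction p arbitrary: r)
    case 0
    have "L 0 r = (if r = 0 then {[]} else {})"
      using card_power_1[of r] by (auto simp: L_def span_empty)
    \<comment> \<open>For \<open>r > 0\<close> the factor \<open>j = 0\<close> contains
      \<open>q ^ 0 - q ^ 0 = 0\<close>.\<close>
    moreover have "F 0 r = (if r = 0 then 1 else 0)"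
      by (cases r) (auto simp: F_def prod.lessThan_Suc_shift simp del: prod.lessThan_Suc)
    ultimately show ?case by simp
  next
    case (Suc p)
    have finX: "finite (?X p r)" "finite (?Y p r)"
      using finL finK finite_subset[OF spanK finK] by (auto intro!: finite_SigmaI)
    have "card (L (Suc p) r) = card (?X p r) + card (?Y p r)"
      unfolding L_Suc[of p r] card_image[OF inj]
      by (rule card_Un_disjoint[OF finX]) auto
    then have "real (card (L (Suc p) r)) = q ^ r * F p r +
        (if r = 0 then 0 else (q ^ k - q ^ (r - 1)) * F p (r - 1))"
      using card_in[of p r] card_out[of p "r - 1"] Suc.IH by (simp add: q_def)
    also have "\<dots> = F (Suc p) r"
    proof (cases r)
      case 0
      then show ?thesis by (simp add: F_def)
    next
      case (Suc s)
      \<comment> \<open>Separating the Gaussian binomial coefficient makes \<open>q_pascal\<close>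
        applicable. The last factor \<open>q ^ k - q ^ s\<close> of the other product is the number
        of vectors that raise the rank from \<open>s\<close>.\<close>
      have split: "F p' r' = (\<Prod>j<r'. (q ^ p' - q ^ j) / (q ^ r' - q ^ j)) * (\<Prod>j<r'. q ^ k - q ^ j)"
        for p' r' unfolding F_def prod.distrib[symmetric] by (rule prod.cong) auto
      have "F (Suc p) (Suc s) = q ^ Suc s * F p (Suc s) + (q ^ k - q ^ s) * F p s"
        unfolding split q_pascal[OF q1]
        by (simp add: algebra_simps)
      then show ?thesis using Suc by simp
    qed
    finally show ?case .
  qed
  show ?thesis using card_L unfolding L_def F_def .
qed

end

subsection \<open>The rank of the next boundary map\<close>

lemma (in vec_space) linear_map_mult_mat_vec:
  assumes "A \<in> carrier_mat n nc"
  shows "linear_map class_ring (module_vec TYPE('a) nc) V ((*\<^sub>v) A)"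
proof -
  interpret W: vec_space "TYPE('a)" nc .
  show ?thesis
    using assms mult_add_distrib_mat_vec[OF assms] mult_mat_vec[OF assms]
    by unfold_locales (auto simp: module_hom_def class_ring_simps)
qed

text \<open>Rank-nullity for multiplication by \<open>A\<close>, whose image is the span of the
  columns.\<close>

lemma kernel_dim_plus_mat_rank:
  fixes A :: "'a::field mat"
  shows "kernel_dim A + mat_rank A = dim_col A"
proof -
  have A: "A \<in> carrier_mat (dim_row A) (dim_col A)" by simp
  interpret N: vec_space "TYPE('a)" "dim_row A" .
  interpret C: vec_space "TYPE('a)" "dim_col A" .
  interpret T: linear_map class_ring "module_vec TYPE('a) (dim_col A)" "module_vec TYPE('a) (dim_row A)" "(*\<^sub>v) A"
    by (rule N.linear_map_mult_mat_vec[OF A])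
  have "T.imT = (*\<^sub>v) A ` carrier_vec (dim_col A)" by (simp add: T.im_def)
  also have "\<dots> = N.span (set (cols A))"
    unfolding N.col_space_eq[OF A, unfolded N.col_space_def]
    by (auto simp: image_iff intro: mult_mat_vec_carrier)
  finally have "T.imT = N.span (set (cols A))" .
  moreover have "T.kerT = mat_kernel A"
    unfolding T.ker_def mat_kernel_def by auto
  ultimately show ?thesis
    using T.rank_nullity[OF C.fin_dim] unfolding mat_rank_def N.rank_def kernel_dim_def C.dim_is_n
    by simp
qed

text \<open>The condition \<open>B * C = 0\<close> constrains each column of \<open>C\<close>
  separately: it must lie in the kernel of \<open>B\<close>. Hence a uniform \<open>C\<close> has
  independent uniform columns there.\<close>

lemma bij_betw_cols_next_boundaries:
  assumes B: "B \<in> carrier_mat (bdry_rows n m) (n m)"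
  shows "bij_betw cols (next_boundaries n m B)
    {vs. set vs \<subseteq> mat_kernel B \<and> length vs = n (Suc m)}"
proof (rule bij_betw_subset[OF bij_betw_cols[of "n m" "n (Suc m)"]])
  show "next_boundaries n m B \<subseteq> carrier_mat (n m) (n (Suc m))"
    by (auto simp: next_boundaries_def)
  have "B * C = 0\<^sub>m (bdry_rows n m) (n (Suc m)) \<longleftrightarrow> set (cols C) \<subseteq> mat_kernel B"
    if C: "C \<in> carrier_mat (n m) (n (Suc m))" for C
  proof -
    have "B * C = 0\<^sub>m (bdry_rows n m) (n (Suc m)) \<longleftrightarrow>
      (\<forall>j<n (Suc m). B *\<^sub>v col C j = 0\<^sub>v (bdry_rows n m))" (is "?l \<longleftrightarrow> ?r")
    proof
      assume ?l
      show ?r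
      proof (intro allI impI)
        fix j assume j: "j < n (Suc m)"
        have "B *\<^sub>v col C j = col (B * C) j" using col_mult2[OF B C j] by simp
        also have "\<dots> = 0\<^sub>v (bdry_rows n m)" using \<open>?l\<close> j by auto
        finally show "B *\<^sub>v col C j = 0\<^sub>v (bdry_rows n m)" .
      qed
    next
      assume ?r
      show ?l
      proof (rule mat_col_eqI)
        fix j assume "j < dim_col (0\<^sub>m (bdry_rows n m) (n (Suc m)))"
        then have j: "j < n (Suc m)" by simp
        show "col (B * C) j = col (0\<^sub>m (bdry_rows n m) (n (Suc m))) j"
          using \<open>?r\<close> j col_mult2[OF B C j] by simp
      qed (use B C in auto)
    qed
    also have "\<dots> \<longleftrightarrow> set (cols C) \<subseteq> mat_kernel B"
      using C B unfolding mat_kernel[OF B] by (auto simp: cols_def image_subset_iff)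
    finally show ?thesis .
  qed
  then have eq: "next_boundaries n m B =
      {C \<in> carrier_mat (n m) (n (Suc m)). set (cols C) \<subseteq> mat_kernel B}"
    unfolding next_boundaries_def by blast
  show "cols ` next_boundaries n m B = {vs. set vs \<subseteq> mat_kernel B \<and> length vs = n (Suc m)}"
  proof (intro equalityI subsetI)
    fix vs assume "vs \<in> {vs. set vs \<subseteq> mat_kernel B \<and> length vs = n (Suc m)}"
    then have vs: "set vs \<subseteq> mat_kernel B" "length vs = n (Suc m)" by auto
    then have "set vs \<subseteq> carrier_vec (n m)" using mat_kernel_carrier[OF B] by blast
    then have "vs \<in> cols ` carrier_mat (n m) (n (Suc m))"
      unfolding bij_betw_imp_surj_on[OF bij_betw_cols] using vs(2) by blast
    with vs(1) show "vs \<in> cols ` next_boundaries n m B" unfolding eq by blast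
  qed (auto simp: eq)
qed

text \<open>Supplies the closure under spans that the counting of lists requires of the
  kernel.\<close>

lemma (in vec_space) submodule_mat_kernel:
  assumes A: "A \<in> carrier_mat nr n"
  shows "submodule class_ring (mat_kernel A) V"
  using A mult_add_distrib_mat_vec[OF A] mult_mat_vec[OF A] mat_kernel[OF A]
  by unfold_locales (auto simp: class_ring_simps)

text \<open>With \<open>k\<close> the nullity of \<open>B\<close> there are q^(k n_(m+1)) admissible
  matrices. The power in front of \<open>rank_prob\<close> is the reciprocal of this number, and the
  product counts those of rank \<open>r\<close>.\<close>

lemma rank_prob_eq_sum:
  fixes B :: "'a::{field, finite} mat"
  assumes B: "B \<in> carrier_mat (bdry_rows n m) (n m)"
  shows "finite (next_boundaries n m B)" "next_boundaries n m B \<noteq> {}"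
    "(\<Sum>C\<in>next_boundaries n m B. of_bool (int (mat_rank C) = r) * pmf (pmf_of_set (next_boundaries n m B)) C)
      = rank_prob CARD('a) n m (kernel_dim B) r" (is "?lhs = _")
proof -
  let ?N = "next_boundaries n m B" and ?k = "kernel_dim B" and ?p = "n (Suc m)"
  interpret finite_vec_space "TYPE('a)" "n m" .
  note bij = bij_betw_cols_next_boundaries[OF B]
  have K: "mat_kernel B \<subseteq> carrier_vec (n m)" by (rule mat_kernel_carrier[OF B])
  have finK: "finite (mat_kernel B)" using K finite_carrier_vec finite_subset by blast
  show fin: "finite ?N"
    using bij_betw_finite[OF bij] finite_lists_length_eq[OF finK, of ?p] by simp
  have card_N: "card ?N = CARD('a) ^ (?k * ?p)"
    using bij_betw_same_card[OF bij] card_lists_length_eq[OF finK, of ?p]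
    by (simp add: card_mat_kernel power_mult)
  then show ne: "?N \<noteq> {}" using fin by fastforce
  have span_K: "span S \<subseteq> mat_kernel B" if "S \<subseteq> mat_kernel B" for S
    using span_is_subset[OF that submodule_mat_kernel[OF B]] .
  have "?lhs = real (card {C \<in> ?N. int (mat_rank C) = r}) / real (card ?N)"
    using fin by (simp add: pmf_of_set[OF ne fin] sum_divide_distrib[symmetric] sum.If_cases of_bool_def Int_def)
  also have "\<dots> = rank_prob CARD('a) n m ?k r"
  \<comment> \<open>No rank is negative, which agrees with the value \<open>0\<close> of
    \<open>rank_prob\<close> there.\<close>
  proof (cases "r < 0")
    case True
    then have "{C \<in> ?N. int (mat_rank C) = r} = {}" by auto
    with True show ?thesis by (simp add: rank_prob_def)
  next
    case False
    have q1: "CARD('a) > 1" by (rule one_less_card_field)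
    have "bij_betw cols {C \<in> ?N. int (mat_rank C) = r}
        {vs. set vs \<subseteq> mat_kernel B \<and> length vs = ?p \<and> card (span (set vs)) = CARD('a) ^ nat r}"
    proof (rule bij_betw_subset[OF bij])
      \<comment> \<open>Powers of \<open>CARD('a) > 1\<close> have distinct values for distinct
        exponents, so the size of the span determines the rank.\<close>
      have "card (span (set (cols C))) = CARD('a) ^ nat r \<longleftrightarrow> int (mat_rank C) = r" if "C \<in> ?N" for C
        using card_span_cols[of C ?p] that False q1 by (auto simp: next_boundaries_def)
      then have "cols ` {C \<in> ?N. int (mat_rank C) = r} =
          {vs \<in> cols ` ?N. card (span (set vs)) = CARD('a) ^ nat r}"
        by blast
      then show "cols ` {C \<in> ?N. int (mat_rank C) = r} =
          {vs. set vs \<subseteq> mat_kernel B \<and> length vs = ?p \<and> card (span (set vs)) = CARD('a) ^ nat r}"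
        unfolding bij_betw_imp_surj_on[OF bij] by simp
    qed auto
    from bij_betw_same_card[OF this] have "real (card {C \<in> ?N. int (mat_rank C) = r}) =
        (\<Prod>j<nat r. (real CARD('a) ^ ?p - real CARD('a) ^ j) * (real CARD('a) ^ ?k - real CARD('a) ^ j)
          / (real CARD('a) ^ nat r - real CARD('a) ^ j))"
      using card_lists_card_span[OF K span_K card_mat_kernel, of ?p "nat r"] by simp
    moreover have "real CARD('a) powi (- int (?k * ?p)) = 1 / real (card ?N)"
      by (simp only: card_N power_int_minus power_int_of_nat of_nat_power inverse_eq_divide)
    ultimately show ?thesis using False by (simp only: rank_prob_def if_False) simp
  qed
  finally show "?lhs = rank_prob CARD('a) n m ?k r" .
qed


lemma finite_carrier_mat [simp]: "finite (carrier_mat n p :: 'a::finite mat set)"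
  using bij_betw_finite[OF bij_betw_cols] finite_lists_length_eq[OF finite_carrier_vec] by blast

text \<open>Gives the deterministic initial state of the chain of nullities: \<open>A 0\<close> has
  nullity \<open>n 0\<close>.\<close>

lemma kernel_dim_no_rows:
  assumes "A \<in> carrier_mat 0 p"
  shows "kernel_dim A = p"
proof -
  interpret vec_space "TYPE('a)" p .
  have "mat_kernel A = carrier_vec p" using assms unfolding mat_kernel[OF assms] by auto
  then show ?thesis using assms dim_is_n by (simp add: kernel_dim_def module_vec_def)
qed

subsection \<open>Random chain complexes\<close>

context uniform_random_chain_complex
begin

lemma boundary_carrier: "\<omega> \<in> space M \<Longrightarrow> A i \<omega> \<in> carrier_mat (bdry_rows n i) (n i)"
  using measurable_space[OF random_boundary[of i]] by simp

lemma boundary_eq_event: "{\<omega> \<in> space M. A i \<omega> = B} \<in> events"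
proof (cases "B \<in> carrier_mat (bdry_rows n i) (n i)")
  case True
  then have "A i -` {B} \<inter> space M \<in> events"
    by (intro measurable_sets[OF random_boundary]) simp
  moreover have "A i -` {B} \<inter> space M = {\<omega> \<in> space M. A i \<omega> = B}" by auto
  ultimately show ?thesis by simp
next
  case False
  then have empty: "{\<omega> \<in> space M. A i \<omega> = B} = {}" using boundary_carrier[of _ i] by auto
  show ?thesis unfolding empty by simp
qed

text \<open>There are only finitely many possible values, so any property of \<open>A i\<close> is a
  finite union of events \<open>A i = B\<close>.\<close>

lemma boundary_event: "{\<omega> \<in> space M. R (A i \<omega>)} \<in> events"
proof -
  have "{\<omega> \<in> space M. R (A i \<omega>)} =
      (\<Union>B\<in>{B \<in> carrier_mat (bdry_rows n i) (n i). R B}. {\<omega> \<in> space M. A i \<omega> = B})"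
    using boundary_carrier[of _ i] by auto
  also have "\<dots> \<in> events"
    using boundary_eq_event by (intro sets.finite_UN) auto
  finally show ?thesis .
qed

section \<open>Conditioning on the history up to degree \<open>m\<close>\<close>

lemma history_event: "{\<omega> \<in> space M. \<forall>i\<le>m. A i \<omega> = B i} \<in> events"
proof -
  have "{\<omega> \<in> space M. \<forall>i\<in>{..m}. A i \<omega> = B i} \<in> events"
    by (rule sets.sets_Collect_finite_All[OF boundary_eq_event]) simp
  then show ?thesis by (simp only: Ball_def atMost_iff)
qed

text \<open>Extensional functions are used so that the set is finite and each outcome has exactly
  one history.\<close>

definition histories :: "nat \<Rightarrow> (nat \<Rightarrow> 'a mat) set" where
  "histories m = (\<Pi>\<^sub>E i\<in>{..m}. carrier_mat (bdry_rows n i) (n i))"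

lemma finite_histories: "finite (histories m)"
  unfolding histories_def by (intro finite_PiE) auto

lemma restrict_in_histories: "\<omega> \<in> space M \<Longrightarrow> restrict (\<lambda>i. A i \<omega>) {..m} \<in> histories m"
  using boundary_carrier by (auto simp: histories_def)

lemma history_unique:
  assumes "B \<in> histories m" "\<forall>i\<le>m. A i \<omega> = B i"
  shows "B = restrict (\<lambda>i. A i \<omega>) {..m}"
  using assms by (intro ext) (auto simp: histories_def PiE_def extensional_def restrict_def)

lemma history_predicate_event:
  assumes Q: "\<And>B B'. \<forall>i\<le>m. B i = B' i \<Longrightarrow> Q B \<longleftrightarrow> Q B'"
  shows "{\<omega> \<in> space M. Q (\<lambda>i. A i \<omega>)} \<in> events"
proof -
  have "{\<omega> \<in> space M. Q (\<lambda>i. A i \<omega>)} =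
      (\<Union>B\<in>{B \<in> histories m. Q B}. {\<omega> \<in> space M. \<forall>i\<le>m. A i \<omega> = B i})"
  proof (intro equalityI subsetI)
    fix \<omega> assume "\<omega> \<in> {\<omega> \<in> space M. Q (\<lambda>i. A i \<omega>)}"
    then have \<omega>: "\<omega> \<in> space M" "Q (\<lambda>i. A i \<omega>)" by simp_all
    let ?B = "restrict (\<lambda>i. A i \<omega>) {..m}"
    have "?B \<in> {B \<in> histories m. Q B}"
      using restrict_in_histories[OF \<omega>(1)] Q[of ?B "\<lambda>i. A i \<omega>"] \<omega>(2) by simp
    then show "\<omega> \<in> (\<Union>B\<in>{B \<in> histories m. Q B}. {\<omega> \<in> space M. \<forall>i\<le>m. A i \<omega> = B i})"
      by (rule UN_I) (use \<omega>(1) in simp)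
  next
    fix \<omega> assume "\<omega> \<in> (\<Union>B\<in>{B \<in> histories m. Q B}. {\<omega> \<in> space M. \<forall>i\<le>m. A i \<omega> = B i})"
    then obtain B where "Q B" "\<omega> \<in> space M" "\<forall>i\<le>m. A i \<omega> = B i" by blast
    then show "\<omega> \<in> {\<omega> \<in> space M. Q (\<lambda>i. A i \<omega>)}" using Q[of "\<lambda>i. A i \<omega>" B] by simp
  qed
  also have "\<dots> \<in> events"
    by (rule sets.finite_UN) (simp add: finite_histories, rule history_event)
  finally show ?thesis .
qed

text \<open>Law of total probability over the finitely many histories. The assumption on
  \<open>Q\<close> says that it depends on degrees up to \<open>m\<close> only, so it can be decided
  on the history \<open>B\<close>.\<close>

lemma prob_history_sum:
  assumes Q: "\<And>B B'. \<forall>i\<le>m. B i = B' i \<Longrightarrow> Q B \<longleftrightarrow> Q B'"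
    and R: "{\<omega> \<in> space M. R \<omega>} \<in> events"
  shows "\<P>(\<omega> in M. Q (\<lambda>i. A i \<omega>) \<and> R \<omega>) =
    (\<Sum>B\<in>{B \<in> histories m. Q B}. \<P>(\<omega> in M. (\<forall>i\<le>m. A i \<omega> = B i) \<and> R \<omega>))"
proof (rule prob_sum)
  show "finite {B \<in> histories m. Q B}" using finite_histories by simp
  show "{\<omega> \<in> space M. (\<forall>i\<le>m. A i \<omega> = B i) \<and> R \<omega>} \<in> events" for B
    by (rule sets.sets_Collect_conj[OF R history_event])
  show "{\<omega> \<in> space M. Q (\<lambda>i. A i \<omega>) \<and> R \<omega>} \<in> events"
    by (rule sets.sets_Collect_conj[OF R history_predicate_event[OF Q]])
  show "AE \<omega> in M. (\<forall>B\<in>{B \<in> histories m. Q B}. (\<forall>i\<le>m. A i \<omega> = B i) \<and> R \<omega> \<longrightarrow>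
        Q (\<lambda>i. A i \<omega>) \<and> R \<omega>) \<and>
      (Q (\<lambda>i. A i \<omega>) \<and> R \<omega> \<longrightarrow>
        (\<exists>!B\<in>{B \<in> histories m. Q B}. (\<forall>i\<le>m. A i \<omega> = B i) \<and> R \<omega>))"
  proof (rule AE_I2, intro conjI ballI impI)
    fix \<omega> B assume "\<omega> \<in> space M" "B \<in> {B \<in> histories m. Q B}" "(\<forall>i\<le>m. A i \<omega> = B i) \<and> R \<omega>"
    then show "Q (\<lambda>i. A i \<omega>)" "R \<omega>" using Q[of B "\<lambda>i. A i \<omega>"] by auto
  next
    fix \<omega> assume \<omega>: "\<omega> \<in> space M" and QR: "Q (\<lambda>i. A i \<omega>) \<and> R \<omega>"
    let ?B = "restrict (\<lambda>i. A i \<omega>) {..m}"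
    have "Q ?B" using QR Q[of ?B "\<lambda>i. A i \<omega>"] by simp
    then show "\<exists>!B\<in>{B \<in> histories m. Q B}. (\<forall>i\<le>m. A i \<omega> = B i) \<and> R \<omega>"
      using restrict_in_histories[OF \<omega>] QR history_unique[of _ m \<omega>]
      by (intro ex1I[of _ ?B]) auto
  qed
qed

text \<open>Conditional uniformity, summed over the possible values of rank \<open>r\<close> of the
  next matrix.\<close>

lemma prob_history_rank:
  assumes B: "B \<in> histories m"
  shows "\<P>(\<omega> in M. (\<forall>i\<le>m. A i \<omega> = B i) \<and> int (mat_rank (A (Suc m) \<omega>)) = r) =
    \<P>(\<omega> in M. \<forall>i\<le>m. A i \<omega> = B i) * rank_prob CARD('a) n m (kernel_dim (B m)) r"
    (is "?l = ?p * _")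
proof (cases "?p = 0")
  \<comment> \<open>Conditional uniformity says nothing about a null history, but then both sides
    vanish.\<close>
  case True
  have "?l \<le> ?p" by (rule finite_measure_mono[OF _ history_event]) auto
  with True show ?thesis by (simp add: measure_le_0_iff)
next
  case False
  then have pos: "?p > 0" by (simp add: zero_less_measure_iff)
  have Bm: "B m \<in> carrier_mat (bdry_rows n m) (n m)" using B by (auto simp: histories_def)
  let ?N = "next_boundaries n m (B m)"
  let ?S = "{C \<in> carrier_mat (n m) (n (Suc m)). int (mat_rank C) = r}"
  note N = rank_prob_eq_sum(1,2)[OF Bm]
  have "?l = (\<Sum>C\<in>?S. \<P>(\<omega> in M. A (Suc m) \<omega> = C \<and> (\<forall>i\<le>m. A i \<omega> = B i)))"
  proof (rule prob_sum)
    show "{\<omega> \<in> space M. A (Suc m) \<omega> = C \<and> (\<forall>i\<le>m. A i \<omega> = B i)} \<in> events" for C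
      by (rule sets.sets_Collect_conj[OF history_event boundary_eq_event])
    show "{\<omega> \<in> space M. (\<forall>i\<le>m. A i \<omega> = B i) \<and> int (mat_rank (A (Suc m) \<omega>)) = r} \<in> events"
      by (rule sets.sets_Collect_conj[OF boundary_event history_event])
  qed (use boundary_carrier[of _ "Suc m"] in \<open>auto intro!: AE_I2\<close>)
  also have "\<dots> = (\<Sum>C\<in>?S. ?p * pmf (pmf_of_set ?N) C)"
    using conditionally_uniform[OF pos] False by (simp add: cond_prob_def field_simps)
  also have "\<dots> = ?p * (\<Sum>C\<in>?S. pmf (pmf_of_set ?N) C)"
    by (simp add: sum_distrib_left)
  also have "(\<Sum>C\<in>?S. pmf (pmf_of_set ?N) C) =
      (\<Sum>C\<in>?N. of_bool (int (mat_rank C) = r) * pmf (pmf_of_set ?N) C)"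
  \<comment> \<open>One sum runs over all matrices of rank \<open>r\<close>, the other over the
    admissible ones. The mass function vanishes off \<open>?N\<close>, the indicator on
    \<open>?N - ?S\<close>.\<close>
  proof (rule sum.mono_neutral_cong)
    show "pmf (pmf_of_set ?N) C = 0" if "C \<in> ?S - ?N" for C
      using that by (simp add: pmf_of_set[OF N(2,1)])
    show "of_bool (int (mat_rank C) = r) * pmf (pmf_of_set ?N) C = 0" if "C \<in> ?N - ?S" for C
      using that by (auto simp: next_boundaries_def)
  qed (use N(1) in auto)
  also have "\<dots> = rank_prob CARD('a) n m (kernel_dim (B m)) r"
    by (rule rank_prob_eq_sum(3)[OF Bm])
  finally show ?thesis .
qed

text \<open>The Markov property: a history enters the law of the next rank only through its last
  nullity. If \<open>Q\<close> fixes that nullity, the common factor leaves the sum over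
  histories.\<close>

lemma prob_history_predicate_rank:
  assumes Q: "\<And>B B'. \<forall>i\<le>m. B i = B' i \<Longrightarrow> Q B \<longleftrightarrow> Q B'"
    and k: "\<And>B. B \<in> histories m \<Longrightarrow> Q B \<Longrightarrow> kernel_dim (B m) = k"
  shows "\<P>(\<omega> in M. Q (\<lambda>i. A i \<omega>) \<and> int (mat_rank (A (Suc m) \<omega>)) = r) =
    \<P>(\<omega> in M. Q (\<lambda>i. A i \<omega>)) * rank_prob CARD('a) n m k r"
proof -
  have "\<P>(\<omega> in M. Q (\<lambda>i. A i \<omega>) \<and> int (mat_rank (A (Suc m) \<omega>)) = r) =
      (\<Sum>B\<in>{B \<in> histories m. Q B}.
        \<P>(\<omega> in M. (\<forall>i\<le>m. A i \<omega> = B i) \<and> int (mat_rank (A (Suc m) \<omega>)) = r))"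
    by (rule prob_history_sum[OF Q boundary_event])
  also have "\<dots> = (\<Sum>B\<in>{B \<in> histories m. Q B}.
      \<P>(\<omega> in M. \<forall>i\<le>m. A i \<omega> = B i)) * rank_prob CARD('a) n m k r"
    unfolding sum_distrib_right by (rule sum.cong) (auto simp: prob_history_rank k)
  also have "(\<Sum>B\<in>{B \<in> histories m. Q B}. \<P>(\<omega> in M. \<forall>i\<le>m. A i \<omega> = B i)) =
      \<P>(\<omega> in M. Q (\<lambda>i. A i \<omega>))"
    using prob_history_sum[of m Q "\<lambda>_. True", OF Q] by simp
  finally show ?thesis .
qed

section \<open>The Markov chain of nullities and the law of \<beta>_m\<close>

lemma kernel_dim_history:
  assumes "B \<in> histories m" "\<forall>l\<in>{1..m}. kernel_dim (B l) = i l"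
  shows "kernel_dim (B m) = (if m = 0 then n 0 else i m)"
  using assms kernel_dim_no_rows[of "B 0" "n 0"] by (auto simp: histories_def PiE_iff)

text \<open>The probability of a path is the product of its transition probabilities. The
  conditional at \<open>l = 1\<close> encodes \<open>i_0 = n_0\<close>, as paths are indexed from
  degree 1.\<close>

lemma prob_kernel_dims:
  assumes "\<And>l. l \<in> {1..m} \<Longrightarrow> i l \<le> n l"
  shows "\<P>(\<omega> in M. \<forall>l\<in>{1..m}. kernel_dim (A l \<omega>) = i l) =
    (\<Prod>l=1..m. rank_prob CARD('a) n (l - 1) (if l = 1 then n 0 else i (l - 1)) (int (n l) - int (i l)))"
  using assms
proof (induction m)
  case 0
  show ?case by (simp add: prob_space)
next
  case (Suc m)
  let ?Q = "\<lambda>B :: nat \<Rightarrow> 'a mat. \<forall>l\<in>{1..m}. kernel_dim (B l) = i l"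
  \<comment> \<open>By rank-nullity, nullity \<open>i (Suc m)\<close> is the same as rank
    \<open>n (Suc m) - i (Suc m)\<close>; the difference is taken in the integers to avoid
    truncation.\<close>
  have "(\<forall>l\<in>{1..Suc m}. kernel_dim (A l \<omega>) = i l) \<longleftrightarrow>
      ?Q (\<lambda>l. A l \<omega>) \<and> int (mat_rank (A (Suc m) \<omega>)) = int (n (Suc m)) - int (i (Suc m))"
    if "\<omega> \<in> space M" for \<omega>
  proof -
    have "kernel_dim (A (Suc m) \<omega>) + mat_rank (A (Suc m) \<omega>) = n (Suc m)"
      using kernel_dim_plus_mat_rank[of "A (Suc m) \<omega>"] boundary_carrier[OF that, of "Suc m"] by simp
    moreover have "{1..Suc m} = insert (Suc m) {1..m}" by auto
    ultimately show ?thesis by auto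
  qed
  then have "\<P>(\<omega> in M. \<forall>l\<in>{1..Suc m}. kernel_dim (A l \<omega>) = i l) =
      \<P>(\<omega> in M. ?Q (\<lambda>l. A l \<omega>) \<and> int (mat_rank (A (Suc m) \<omega>)) = int (n (Suc m)) - int (i (Suc m)))"
    by (intro arg_cong[of _ _ prob] Collect_cong) blast
  also have "\<dots> = \<P>(\<omega> in M. ?Q (\<lambda>l. A l \<omega>)) *
      rank_prob CARD('a) n m (if m = 0 then n 0 else i m) (int (n (Suc m)) - int (i (Suc m)))"
    by (rule prob_history_predicate_rank) (auto simp: kernel_dim_history)
  finally show ?case using Suc by simp
qed

text \<open>Split according to the path of nullities in degrees 1 to \<open>m\<close>. Since
  \<open>m \<ge> 1\<close>, the path fixes the nullity \<open>i m\<close>, and \<beta>_m = b then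
  says that the next rank is \<open>i m - b\<close>: one more transition.\<close>

lemma prob_betti:
  assumes "m \<ge> 1"
  shows "\<P>(\<omega> in M. betti (\<lambda>k. A k \<omega>) m = b) =
    (\<Sum>i\<in>(\<Pi>\<^sub>E l\<in>{1..m}. {0..n l}).
       rank_prob CARD('a) n m (i m) (int (i m) - b) *
       (\<Prod>l=1..m. rank_prob CARD('a) n (l - 1) (if l = 1 then n 0 else i (l - 1)) (int (n l) - int (i l))))"
    (is "_ = sum ?f ?I")
proof -
  let ?Q = "\<lambda>i B. \<forall>l\<in>{1..m}. kernel_dim (B l :: 'a mat) = i l"
  let ?E = "\<lambda>i \<omega>. ?Q i (\<lambda>l. A l \<omega>) \<and> int (mat_rank (A (Suc m) \<omega>)) = int (i m) - b"
  have "\<P>(\<omega> in M. betti (\<lambda>k. A k \<omega>) m = b) = (\<Sum>i\<in>?I. \<P>(\<omega> in M. ?E i \<omega>))"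
  proof (rule prob_sum)
    show "finite ?I" by (intro finite_PiE) auto
    show "{\<omega> \<in> space M. ?E i \<omega>} \<in> events" for i
      by (rule sets.sets_Collect_conj[OF boundary_event
            sets.sets_Collect_finite_All[OF boundary_event]]) simp
    show "{\<omega> \<in> space M. betti (\<lambda>k. A k \<omega>) m = b} \<in> events"
      \<comment> \<open>The Betti number involves \<open>A (Suc m)\<close>, so the history must
        reach one degree further.\<close>
      using history_predicate_event[of "Suc m" "\<lambda>B. betti B m = b"] by (simp add: betti_def)
    show "AE \<omega> in M. (\<forall>i\<in>?I. ?E i \<omega> \<longrightarrow> betti (\<lambda>k. A k \<omega>) m = b) \<and>
        (betti (\<lambda>k. A k \<omega>) m = b \<longrightarrow> (\<exists>!i\<in>?I. ?E i \<omega>))"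
    proof (rule AE_I2, intro conjI ballI impI)
      fix \<omega> i assume "?E i \<omega>"
      then show "betti (\<lambda>k. A k \<omega>) m = b" using assms by (auto simp: betti_def)
    next
      fix \<omega> assume \<omega>: "\<omega> \<in> space M" and b: "betti (\<lambda>k. A k \<omega>) m = b"
      \<comment> \<open>The only possible path is that of the actual nullities; restriction makes it
        an element of the extensional product.\<close>
      let ?i = "restrict (\<lambda>l. kernel_dim (A l \<omega>)) {1..m}"
      have "kernel_dim (A l \<omega>) \<le> n l" for l
        using kernel_dim_plus_mat_rank[of "A l \<omega>"] boundary_carrier[OF \<omega>, of l] by simp
      then have "?i \<in> ?I" by auto
      moreover have "?E ?i \<omega>" using b assms by (auto simp: betti_def)
      moreover have "i = ?i" if "i \<in> ?I" "?E i \<omega>" for i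
        using that by (intro ext) (auto simp: PiE_def extensional_def restrict_def)
      ultimately show "\<exists>!i\<in>?I. ?E i \<omega>" by (intro ex1I[of _ ?i]) blast+
    qed
  qed
  also have "\<dots> = sum ?f ?I"
  proof (rule sum.cong)
    fix i assume i: "i \<in> ?I"
    then have le: "i l \<le> n l" if "l \<in> {1..m}" for l using that by (auto simp: PiE_iff)
    have "\<P>(\<omega> in M. ?E i \<omega>) = \<P>(\<omega> in M. ?Q i (\<lambda>l. A l \<omega>)) * rank_prob CARD('a) n m (i m) (int (i m) - b)"
      by (rule prob_history_predicate_rank) (use assms in auto)
    also have "\<dots> = ?f i" using prob_kernel_dims[of m i, OF le] by (simp only: mult.commute)
    finally show "\<P>(\<omega> in M. ?E i \<omega>) = ?f i" .
  qed simp
  finally show ?thesis .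
qed

end

theorem theorem1:
  fixes q :: nat and n :: "nat \<Rightarrow> nat"
    and M :: "'w measure" and A :: "nat \<Rightarrow> 'w \<Rightarrow> 'a::{field, finite} mat"
    and m :: nat and b :: int
  assumes "prime q" and "CARD('a) = q"
    and "uniform_random_chain_complex M n A"
    and "m \<ge> 1"
  shows "\<P>(\<omega> in M. betti (\<lambda>k. A k \<omega>) m = b) =
    (\<Sum>i\<in>(\<Pi>\<^sub>E l\<in>{1..m}. {0..n l}).
       rank_prob q n m (i m) (int (i m) - b) *
       (\<Prod>l=1..m. rank_prob q n (l - 1) (if l = 1 then n 0 else i (l - 1)) (int (n l) - int (i l))))"
  using uniform_random_chain_complex.prob_betti[OF assms(3,4)] assms(2) by simp

end
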